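(* Let $n\ge 2$, let $w$ be a non-empty braid word in $B_n$ in normal form with $k=\deg(w)\ge 1$, and run the randomized procedure TestRandomHalfTwist on $w$ with maximum number of tries $i\ge 1$. (1) If the procedure returns true, with output braid word $q$ and output generator $c\in\{\sigma_1,\dots,\sigma_{n-1}\}$, then $q^{-1}wq=c^k$ in $B_n$. (2) Suppose that $w$ is a half-twist to the $k$-th power. Let $p'$ be the probability that IsHalfTwist gives an erroneous result (i.e. false) on $w$ itself, and let $p$ be the probability that IsHalfTwist gives an erroneous result (i.e. false) on the normal form of a random conjugate $r^{-1}wr$ of $w$. Then the probability that the procedure returns an incorrect false is $p'\cdot p^{\,i-1}$.
   Context: $B_n$ is Artin's braid group, generated by $\sigma_1,\dots,\sigma_{n-1}$ with relations $\sigma_i\sigma_j=\sigma_j\sigma_i$ for $|i-j|\ge 2$ and $\sigma_i\sigma_{i+1}\sigma_i=\sigma_{i+1}\sigma_i\sigma_{i+1}$ for $1\le i\le n-2$. A half-twist is an element of the conjugacy class of $\sigma_1$ in $B_n$; a half-twist to the $k$-th power is an element $\beta^k$ with $\beta$ a half-twist, i.e. a conjugate of $\sigma_1^k$. A braid word is a finite sequence $\sigma_{i_1}^{e_1}\cdots\sigma_{i_l}^{e_l}$ with $e_j\in\{1,-1\}$; its length is $l$ and its degree is $\deg(w)=e_1+\dots+e_l$. Letters are numbered $1,\dots,l$; $w_{i,j}$ denotes the part of $w$ from the $i$-th to the $j$-th letter, and it is the empty word if $j<i$. A positive braid word is one with all $e_j=1$. A braid word is in normal form if it is $\Delta_n^{-r}w'$,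 where $\Delta_n=(\sigma_1\cdots\sigma_{n-1})(\sigma_1\cdots\sigma_{n-2})\cdots(\sigma_1\sigma_2)\sigma_1$, $r\ge 0$ is minimal and $w'$ is a positive braid word which is lexicographically smallest among the positive words representing the same element. The procedure Normalize replaces a braid word by the word in normal form representing the same element. Subroutines. For positive braid words $u,v$: WordExtractLeft$(u,v)$ returns false if there is no positive word $v''$ such that $u$ and $vv''$ represent the same element; otherwise it rewrites $u$ as a positive word $vv''$ of the same length representing the same element. WordExtractRight$(u,v)$ is the same with $v''v$ in place of $vv''$. Extracting the empty word always succeeds. Algorithm IsHalfTwist$(w,k)$. Let $iPos$ be the position of the first positive letter of $w$ and $l$ the length of $w$. For $j=1,\dots,n-1$, for $t=0,\dots,k$, for $p=iPos-1,\dots,l$ do the following. (a) Apply WordExtractRight$(w_{iPos,p},\sigma_j^t)$; if it returns false, continue with the next $p$; otherwise replace $w_{iPos,p}$ inside $w$ by the rewritten word ending in $\sigma_j^t$. (b) Apply WordExtractLeft$(w_{p+1,l},\sigma_j^{k-t})$; if it returns false, continue with the next $p$; otherwise replace $w_{p+1,l}$ inside $w$ by the rewritten word beginning with $\sigma_j^{k-t}$. (c) Put $Test=w_{1,p-t}\,w_{p+k-t+1,l}$ and $q=(w_{p+k-t+1,l})^{-1}$. If $Test$ represents the identity of $B_n$, return true together with $q$ and $\sigma_j$. If the loops end without returning, return false. The algorithm may also return a "genuine false" when the input word fails one of the following tests, each of which is a necessary condition for being a half-twist to the $k$-th power: the permutation of strings induced by the word is the identity if $k$ is even and a transposition if $k$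 is odd; if $k$ is even, exactly one pair of strings has a non-zero signed number of mutual crossings; deleting the two distinguished strings (that pair if $k$ is even, the transposed strings if $k$ is odd) gives the trivial braid in $B_{n-2}$. Procedure TestRandomHalfTwist$(w)$. Set $r=\mathrm{Id}$, $r_1=w$, $k=\deg(w)$. Repeat, at most a prescribed maximum number of times (the maximum number of tries): run IsHalfTwist$(r_1,k)$. If it returns true with outputs $q_0$ and $\sigma_j$, output $q=r\cdot q_0$ and $c=\sigma_j$ and return true. If it returns a genuine false, return a genuine false. Otherwise choose $r$ to be a random braid word of length equal to the length of $w$ (the random choices in different iterations being independent and identically distributed), set $r_1=\mathrm{Normalize}(r^{-1}wr)$, and go to the next iteration. If the maximum number of tries has been reached, return false (not genuine). Since $w$ is fixed and IsHalfTwist is deterministic, $p'$ is $1$ if IsHalfTwist errs on $w$ and $0$ otherwise, while $p$ refers to the random choice of $r$. *)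

theory Defs
  imports
    "HOL-Algebra.Group"
    "HOL-Library.List_Lexorder"
    "HOL-Combinatorics.Transposition"
    "HOL-Probability.Probability_Mass_Function"
begin

section \<open>Braid words and braid groups\<close>

text \<open>The letter \<open>(i, True)\<close> stands for the generator with index \<open>i\<close>, and \<open>(i, False)\<close> for
  its inverse.\<close>

type_synonym braid_word = "(nat \<times> bool) list"

definition braid_words :: "nat \<Rightarrow> braid_word set" where
  "braid_words n = lists ({1..<n} \<times> UNIV)"

definition positive_words :: "nat \<Rightarrow> braid_word set" where
  "positive_words n = lists ({1..<n} \<times> {True})"

definition word_inv :: "braid_word \<Rightarrow> braid_word" where
  "word_inv w = rev (map (\<lambda>(i, e). (i, \<not> e)) w)"

definition degree :: "braid_word \<Rightarrow> int" where
  "degree w = (\<Sum>(i, e)\<leftarrow>w. if e then 1 else - 1)"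

text \<open>The congruence on braid words given by Artin's presentation.\<close>

inductive braid_eq :: "nat \<Rightarrow> braid_word \<Rightarrow> braid_word \<Rightarrow> bool" for n where
  refl: "w \<in> braid_words n \<Longrightarrow> braid_eq n w w"
| sym: "braid_eq n u v \<Longrightarrow> braid_eq n v u"
| trans: "braid_eq n u v \<Longrightarrow> braid_eq n v w \<Longrightarrow> braid_eq n u w"
| append: "braid_eq n u u' \<Longrightarrow> braid_eq n v v' \<Longrightarrow> braid_eq n (u @ v) (u' @ v')"
| cancel: "1 \<le> i \<Longrightarrow> i < n \<Longrightarrow> braid_eq n [(i, e), (i, \<not> e)] []"
| commute: "1 \<le> i \<Longrightarrow> i + 2 \<le> j \<Longrightarrow> j < n \<Longrightarrow>
    braid_eq n [(i, True), (j, True)] [(j, True), (i, True)]"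
| braid: "1 \<le> i \<Longrightarrow> i + 1 < n \<Longrightarrow>
    braid_eq n [(i, True), (i + 1, True), (i, True)] [(i + 1, True), (i, True), (i + 1, True)]"

definition braid_of :: "nat \<Rightarrow> braid_word \<Rightarrow> braid_word set" where
  "braid_of n w = {v. braid_eq n w v}"

definition braid_group :: "nat \<Rightarrow> braid_word set monoid" where
  "braid_group n =
    \<lparr>carrier = braid_of n ` braid_words n,
     monoid.mult = (\<lambda>A B. \<Union>u\<in>A. \<Union>v\<in>B. braid_of n (u @ v)),
     monoid.one = braid_of n []\<rparr>"

lemma braid_words_simps [simp]:
  "[] \<in> braid_words n"
  "u @ v \<in> braid_words n \<longleftrightarrow> u \<in> braid_words n \<and> v \<in> braid_words n"
  "(i, e) # v \<in> braid_words n \<longleftrightarrow> 1 \<le> i \<and> i < n \<and> v \<in> braid_words n"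
  by (auto simp: braid_words_def)

lemma word_inv_in_braid_words [simp]: "word_inv w \<in> braid_words n \<longleftrightarrow> w \<in> braid_words n"
  by (induction w) (auto simp: word_inv_def)

lemma braid_eq_in_braid_words:
  "braid_eq n u v \<Longrightarrow> u \<in> braid_words n \<and> v \<in> braid_words n"
  by (induction rule: braid_eq.induct) auto

lemma braid_of_eq_iff:
  assumes "u \<in> braid_words n"
  shows "braid_of n u = braid_of n v \<longleftrightarrow> braid_eq n u v"
proof
  assume "braid_of n u = braid_of n v"
  moreover have "u \<in> braid_of n u"
    using assms by (simp add: braid_of_def braid_eq.refl)
  ultimately show "braid_eq n u v"
    by (auto simp: braid_of_def intro: braid_eq.sym)
next
  assume "braid_eq n u v"
  then show "braid_of n u = braid_of n v"
    by (auto simp: braid_of_def intro: braid_eq.sym braid_eq.trans)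
qed

lemma braid_group_mult:
  assumes "u \<in> braid_words n" "v \<in> braid_words n"
  shows "braid_of n u \<otimes>\<^bsub>braid_group n\<^esub> braid_of n v = braid_of n (u @ v)"
proof -
  have *: "braid_of n (u' @ v') = braid_of n (u @ v)"
    if "u' \<in> braid_of n u" "v' \<in> braid_of n v" for u' v'
  proof -
    have "braid_eq n (u @ v) (u' @ v')"
      using that by (auto simp: braid_of_def intro: braid_eq.append)
    then show ?thesis
      using assms by (simp add: braid_of_eq_iff[symmetric])
  qed
  have "u \<in> braid_of n u" "v \<in> braid_of n v"
    using assms by (simp_all add: braid_of_def braid_eq.refl)
  then have "(\<Union>u'\<in>braid_of n u. \<Union>v'\<in>braid_of n v. braid_of n (u' @ v')) = braid_of n (u @ v)"
    using * by blast
  then show ?thesis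
    by (simp add: braid_group_def)
qed

lemma braid_eq_inv_left:
  assumes "w \<in> braid_words n"
  shows "braid_eq n (word_inv w @ w) []"
  using assms
proof (induction w)
  case Nil
  then show ?case by (simp add: word_inv_def braid_eq.refl)
next
  case (Cons a w)
  obtain i e where a: "a = (i, e)" by (cases a)
  have ie: "1 \<le> i" "i < n" and w: "w \<in> braid_words n"
    using Cons.prems a by auto
  have "braid_eq n [(i, \<not> e), (i, e)] []"
    using braid_eq.cancel[OF ie, of "\<not> e"] by simp
  then have "braid_eq n ([(i, \<not> e), (i, e)] @ w) ([] @ w)"
    using w by (rule braid_eq.append[OF _ braid_eq.refl])
  then have "braid_eq n (word_inv w @ ([(i, \<not> e), (i, e)] @ w)) (word_inv w @ ([] @ w))"
    using w by (intro braid_eq.append[OF braid_eq.refl]) simp_all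
  then show ?case
    using Cons.IH[OF w] by (auto simp: a word_inv_def intro: braid_eq.trans)
qed

lemma group_braid_group: "group (braid_group n)"
proof (rule groupI)
  fix x assume "x \<in> carrier (braid_group n)"
  then obtain w where w: "w \<in> braid_words n" "x = braid_of n w"
    by (auto simp: braid_group_def)
  have "braid_of n (word_inv w) \<otimes>\<^bsub>braid_group n\<^esub> x = \<one>\<^bsub>braid_group n\<^esub>"
    using w braid_eq_inv_left[OF w(1)] braid_of_eq_iff[of "word_inv w @ w" n "[]"]
    by (simp add: braid_group_mult) (simp add: braid_group_def)
  moreover have "braid_of n (word_inv w) \<in> carrier (braid_group n)"
    using w by (simp add: braid_group_def)
  ultimately show "\<exists>y\<in>carrier (braid_group n). y \<otimes>\<^bsub>braid_group n\<^esub> x = \<one>\<^bsub>braid_group n\<^esub>"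
    by blast
next
  fix x assume "x \<in> carrier (braid_group n)"
  then obtain w where "w \<in> braid_words n" "x = braid_of n w"
    by (auto simp: braid_group_def)
  then show "\<one>\<^bsub>braid_group n\<^esub> \<otimes>\<^bsub>braid_group n\<^esub> x = x"
    using braid_group_mult[of "[]" n w] by (simp add: braid_group_def)
next
  fix x y assume "x \<in> carrier (braid_group n)" "y \<in> carrier (braid_group n)"
  then obtain u v where "u \<in> braid_words n" "x = braid_of n u"
      "v \<in> braid_words n" "y = braid_of n v"
    by (auto simp: braid_group_def)
  then show "x \<otimes>\<^bsub>braid_group n\<^esub> y \<in> carrier (braid_group n)"
    by (simp add: braid_group_mult) (simp add: braid_group_def)
next
  fix x y z
  assume "x \<in> carrier (braid_group n)" "y \<in> carrier (braid_group n)" "z \<in> carrier (braid_group n)"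
  then obtain u v w where "u \<in> braid_words n" "x = braid_of n u"
      "v \<in> braid_words n" "y = braid_of n v" "w \<in> braid_words n" "z = braid_of n w"
    by (auto simp: braid_group_def)
  then show "x \<otimes>\<^bsub>braid_group n\<^esub> y \<otimes>\<^bsub>braid_group n\<^esub> z =
      x \<otimes>\<^bsub>braid_group n\<^esub> (y \<otimes>\<^bsub>braid_group n\<^esub> z)"
    by (simp add: braid_group_mult)
qed (simp add: braid_group_def)

definition half_twist :: "nat \<Rightarrow> braid_word set \<Rightarrow> bool" where
  "half_twist n b \<longleftrightarrow> (\<exists>g\<in>carrier (braid_group n).
    b = g \<otimes>\<^bsub>braid_group n\<^esub> braid_of n [(1, True)] \<otimes>\<^bsub>braid_group n\<^esub> inv\<^bsub>braid_group n\<^esub> g)"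

definition half_twist_power :: "nat \<Rightarrow> nat \<Rightarrow> braid_word set \<Rightarrow> bool" where
  "half_twist_power n k x \<longleftrightarrow> (\<exists>b. half_twist n b \<and> x = b [^]\<^bsub>braid_group n\<^esub> k)"


section \<open>Normal form\<close>

definition Delta :: "nat \<Rightarrow> braid_word" where
  "Delta n = concat (map (\<lambda>m. map (\<lambda>i. (i, True)) [1..<Suc m]) (rev [1..<n]))"

definition Delta_neg_power :: "nat \<Rightarrow> nat \<Rightarrow> braid_word" where
  "Delta_neg_power n r = concat (replicate r (word_inv (Delta n)))"

text \<open>Words are compared lexicographically through their lists of generator indices.\<close>

definition normal_form :: "nat \<Rightarrow> braid_word \<Rightarrow> bool" where
  "normal_form n v \<longleftrightarrow> (\<exists>r. \<exists>w'\<in>positive_words n.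
     v = Delta_neg_power n r @ w' \<and>
     (\<forall>s<r. \<not> (\<exists>u\<in>positive_words n. braid_of n (Delta_neg_power n s @ u) = braid_of n v)) \<and>
     (\<forall>u\<in>positive_words n. braid_of n u = braid_of n w' \<longrightarrow> map fst w' \<le> map fst u))"

definition Normalize :: "nat \<Rightarrow> braid_word \<Rightarrow> braid_word" where
  "Normalize n v = (THE u. normal_form n u \<and> braid_of n u = braid_of n v)"


section \<open>The word extraction subroutines\<close>

text \<open>The way in which the subroutines rewrite a word is left open: an implementation is any function
  satisfying the specification, with \<open>None\<close> as the answer ``false''.\<close>

definition extracts_left ::
    "nat \<Rightarrow> (braid_word \<Rightarrow> braid_word \<Rightarrow> braid_word option) \<Rightarrow> bool" where
  "extracts_left n X \<longleftrightarrow> (\<forall>u\<in>positive_words n. \<forall>v\<in>positive_words n.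
     case X u v of
       None \<Rightarrow> \<not> (\<exists>v''\<in>positive_words n. braid_of n u = braid_of n (v @ v''))
     | Some u' \<Rightarrow> (\<exists>v''\<in>positive_words n. u' = v @ v'') \<and>
         length u' = length u \<and> braid_of n u' = braid_of n u)"

definition extracts_right ::
    "nat \<Rightarrow> (braid_word \<Rightarrow> braid_word \<Rightarrow> braid_word option) \<Rightarrow> bool" where
  "extracts_right n X \<longleftrightarrow> (\<forall>u\<in>positive_words n. \<forall>v\<in>positive_words n.
     case X u v of
       None \<Rightarrow> \<not> (\<exists>v''\<in>positive_words n. braid_of n u = braid_of n (v'' @ v))
     | Some u' \<Rightarrow> (\<exists>v''\<in>positive_words n. u' = v'' @ v) \<and>
         length u' = length u \<and> braid_of n u' = braid_of n u)"


section \<open>Necessary conditions for half-twist powers\<close>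

text \<open>Strings are named by their initial positions; \<open>string_perm w s\<close> is the final position of the
  string \<open>s\<close>.\<close>

fun string_perm :: "braid_word \<Rightarrow> nat \<Rightarrow> nat" where
  "string_perm [] s = s"
| "string_perm ((i, e) # w) s = string_perm w (Transposition.transpose i (i + 1) s)"

text \<open>The signed number of mutual crossings of the strings \<open>a\<close> and \<open>b\<close>; in the recursion, \<open>a\<close> and
  \<open>b\<close> are the current positions of the two strings.\<close>

fun crossings :: "braid_word \<Rightarrow> nat \<Rightarrow> nat \<Rightarrow> int" where
  "crossings [] a b = 0"
| "crossings ((i, e) # w) a b =
     (if {a, b} = {i, i + 1} then if e then 1 else - 1 else 0) +
     crossings w (Transposition.transpose i (i + 1) a) (Transposition.transpose i (i + 1) b)"

text \<open>Deletion of the strings at the positions in \<open>S\<close>. A crossing involving a deleted string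
  disappears; for any other one, the index drops by the number of deleted strings to its left.\<close>

fun delete_strings :: "nat set \<Rightarrow> braid_word \<Rightarrow> braid_word" where
  "delete_strings S [] = []"
| "delete_strings S ((i, e) # w) =
     (if i \<in> S \<or> i + 1 \<in> S then [] else [(i - card {s \<in> S. s < i}, e)]) @
     delete_strings (Transposition.transpose i (i + 1) ` S) w"

definition passes_tests :: "nat \<Rightarrow> nat \<Rightarrow> braid_word \<Rightarrow> bool" where
  "passes_tests n k v \<longleftrightarrow>
    (if even k then
       (\<forall>s\<in>{1..n}. string_perm v s = s) \<and>
       (\<exists>a b. {(x, y). 1 \<le> x \<and> x < y \<and> y \<le> n \<and> crossings v x y \<noteq> 0} = {(a, b)} \<and>
          braid_of (n - 2) (delete_strings {a, b} v) = \<one>\<^bsub>braid_group (n - 2)\<^esub>)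
     else
       (\<exists>a b. 1 \<le> a \<and> a < b \<and> b \<le> n \<and>
          (\<forall>s\<in>{1..n}. string_perm v s = Transposition.transpose a b s) \<and>
          braid_of (n - 2) (delete_strings {a, b} v) = \<one>\<^bsub>braid_group (n - 2)\<^esub>))"


section \<open>The algorithms\<close>

text \<open>The answer ``true'' carries the output word \<open>q\<close> and the index \<open>j\<close> of the output generator.\<close>

datatype verdict = Yes braid_word nat | No | Genuine_No

definition says_false :: "verdict \<Rightarrow> bool" where
  "says_false a \<longleftrightarrow> a = No \<or> a = Genuine_No"

definition part :: "braid_word \<Rightarrow> nat \<Rightarrow> nat \<Rightarrow> braid_word" where
  "part w i j = take (j + 1 - i) (drop (i - 1) w)"

definition first_positive :: "braid_word \<Rightarrow> nat" where
  "first_positive w = length (takeWhile (\<lambda>(i, e). \<not> e) w) + 1"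

text \<open>The list argument enumerates the loop indices \<open>(j, t, p)\<close> still to be processed; the last
  argument is the current state of the word, which keeps all rewritings made so far.\<close>

context
  fixes XL XR :: "braid_word \<Rightarrow> braid_word \<Rightarrow> braid_word option"
    and genuine :: "nat \<Rightarrow> braid_word \<Rightarrow> bool"
    and n :: nat
begin

fun half_twist_loop ::
    "nat \<Rightarrow> nat \<Rightarrow> nat \<Rightarrow> (nat \<times> nat \<times> nat) list \<Rightarrow> braid_word \<Rightarrow> verdict" where
  "half_twist_loop k iPos l [] w = No"
| "half_twist_loop k iPos l ((j, t, p) # rest) w =
    (case XR (part w iPos p) (replicate t (j, True)) of
       None \<Rightarrow> half_twist_loop k iPos l rest w
     | Some u \<Rightarrow>
         let w1 = part w 1 (iPos - 1) @ u @ part w (p + 1) l in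
         (case XL (part w1 (p + 1) l) (replicate (k - t) (j, True)) of
            None \<Rightarrow> half_twist_loop k iPos l rest w1
          | Some u' \<Rightarrow>
              let w2 = part w1 1 p @ u';
                  Test = part w2 1 (p - t) @ part w2 (p + k - t + 1) l;
                  q = word_inv (part w2 (p + k - t + 1) l)
              in if braid_of n Test = \<one>\<^bsub>braid_group n\<^esub> then Yes q j
                 else half_twist_loop k iPos l rest w2))"

text \<open>The predicate \<open>genuine\<close> decides when the algorithm makes use of its right to return a genuine
  false.\<close>

definition IsHalfTwist :: "braid_word \<Rightarrow> nat \<Rightarrow> verdict" where
  "IsHalfTwist w k =
    (if genuine k w then Genuine_No
     else let iPos = first_positive w; l = length w in
       half_twist_loop k iPos l
         [(j, t, p). j \<leftarrow> [1..<n], t \<leftarrow> [0..<k + 1], p \<leftarrow> [iPos - 1..<l + 1]] w)"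

text \<open>Here \<open>D\<close> is the distribution of the random words. The first numerical argument of the loop is
  the number of tries left; each iteration makes a fresh, hence independent, draw from \<open>D\<close>.\<close>

fun random_loop ::
    "braid_word pmf \<Rightarrow> braid_word \<Rightarrow> nat \<Rightarrow> nat \<Rightarrow> braid_word \<Rightarrow> braid_word \<Rightarrow> verdict pmf" where
  "random_loop D w k 0 r r1 = return_pmf No"
| "random_loop D w k (Suc m) r r1 =
    (case IsHalfTwist r1 k of
       Yes q0 j \<Rightarrow> return_pmf (Yes (r @ q0) j)
     | Genuine_No \<Rightarrow> return_pmf Genuine_No
     | No \<Rightarrow> bind_pmf D (\<lambda>r'. random_loop D w k m r' (Normalize n (word_inv r' @ w @ r'))))"

definition TestRandomHalfTwist :: "braid_word pmf \<Rightarrow> nat \<Rightarrow> braid_word \<Rightarrow> verdict pmf" where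
  "TestRandomHalfTwist D tries w = random_loop D w (nat (degree w)) tries [] w"

end

end

theory Submission
  imports Defs
begin

text \<open>If \<open>IsHalfTwist\<close> answers true, it has rewritten its input as \<open>A s B\<close> with
  \<open>s = \<sigma>\<^sub>j\<^sup>k\<close> and \<open>A B = 1\<close>, so conjugation by \<open>q = B\<^sup>-\<^sup>1\<close> turns the input into \<open>s\<close>; conjugating
  further by the random word \<open>r\<close> gives the first claim. For the second claim, the permutation of the strings,
  their pairwise crossing numbers and the deletion of strings are invariants of braids, hence every
  half-twist power passes the tests and a genuine false never occurs on a conjugate of the input.
  The tries are then independent and each fails with probability \<open>p\<close>, except the first one, which fails
  with probability \<open>p'\<close>. That the random conjugates have a normal form at all is
  Garside's argument: \<open>\<Delta> \<sigma>\<^sub>i = \<sigma>\<^sub>n\<^sub>-\<^sub>i \<Delta>\<close>, and every generator is a right divisor of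
  \<open>\<Delta>\<close>, so all inverse letters can be collected in a power of \<open>\<Delta>\<^sup>-\<^sup>1\<close> on the left.\<close>

section \<open>Invariants of braids\<close>

lemma transpose_image_mem_iff:
  "x \<in> Transposition.transpose a b ` S \<longleftrightarrow> Transposition.transpose a b x \<in> S"
  by (metis image_iff transpose_involutory)

lemma card_transpose_image [simp]: "card (Transposition.transpose a b ` S) = card S"
  by (simp add: card_image)

lemma string_perm_append: "string_perm (u @ v) s = string_perm v (string_perm u s)"
  by (induction u s rule: string_perm.induct) auto

lemma crossings_append:
  "crossings (u @ v) a b = crossings u a b + crossings v (string_perm u a) (string_perm u b)"
  by (induction u a b rule: crossings.induct) auto

lemma delete_strings_append:
  "delete_strings S (u @ v) = delete_strings S u @ delete_strings (string_perm u ` S) v"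
  by (induction S u rule: delete_strings.induct) (auto simp: image_image)

lemma string_perm_invariant: "braid_eq n u v \<Longrightarrow> string_perm u s = string_perm v s"
  by (induction arbitrary: s rule: braid_eq.induct)
    (auto simp: string_perm_append Transposition.transpose_def)

text \<open>Carries a transposition over from the strings to the positions where they cross, so that
  every crossing condition becomes one on the initial pair \<open>{a, b}\<close>.\<close>

lemma transpose_doubleton_eq_iff:
  "{Transposition.transpose i j a, Transposition.transpose i j b} = {c, d} \<longleftrightarrow>
   {a, b} = {Transposition.transpose i j c, Transposition.transpose i j d}"
  by (auto simp: doubleton_eq_iff)

text \<open>Two cancelling letters cross one pair of strings with opposite signs; the two sides of
  each other relation cross the same pairs in a different order.\<close>

lemma crossings_invariant: "braid_eq n u v \<Longrightarrow> crossings u a b = crossings v a b"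
proof (induction arbitrary: a b rule: braid_eq.induct)
  case (append u u' v v')
  then show ?case by (simp add: crossings_append string_perm_invariant)
next
  case (cancel i e)
  then show ?case by (simp add: transpose_doubleton_eq_iff insert_commute)
next
  case (commute i j)
  then have "Transposition.transpose i (i + 1) j = j"
    "Transposition.transpose i (i + 1) (j + 1) = j + 1"
    "Transposition.transpose j (j + 1) i = i"
    "Transposition.transpose j (j + 1) (i + 1) = i + 1"
    by (auto simp: Transposition.transpose_def)
  then show ?case by (simp add: transpose_doubleton_eq_iff)
next
  case (braid i)
  \<comment> \<open>In terms of initial positions the left side crosses \<open>{i, i + 1}\<close>,
    \<open>{i, i + 2}\<close>, \<open>{i + 1, i + 2}\<close>, and the right side crosses them in
    reverse order.\<close>
  have "Transposition.transpose i (i + 1) (i + 2) = i + 2"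
    "Transposition.transpose (i + 1) (i + 2) i = i"
    by (auto simp: Transposition.transpose_def)
  then show ?case by (simp add: transpose_doubleton_eq_iff insert_commute)
qed simp_all

lemma string_perm_image_subset:
  assumes "w \<in> braid_words n" "S \<subseteq> {1..n}"
  shows "string_perm w ` S \<subseteq> {1..n}"
  using assms
proof (induction w arbitrary: S)
  case (Cons x w)
  obtain i e where x: "x = (i, e)" by (cases x)
  have "Transposition.transpose i (i + 1) ` S \<subseteq> {1..n}"
    using Cons.prems x by (auto simp: Transposition.transpose_def split: if_splits)
  then have "string_perm w ` Transposition.transpose i (i + 1) ` S \<subseteq> {1..n}"
    using Cons.IH Cons.prems x by auto
  then show ?case
    by (simp add: x image_image)
qed auto

lemma inj_string_perm: "inj (string_perm w)"
proof (induction w)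
  case (Cons x w)
  obtain i e where x: "x = (i, e)" by (cases x)
  have "string_perm (x # w) = string_perm w \<circ> Transposition.transpose i (i + 1)"
    by (auto simp: x)
  then show ?case using Cons by (metis bij_betw_def bij_transpose inj_compose)
qed auto

section \<open>The index shift caused by deleted strings\<close>

definition count_below :: "nat set \<Rightarrow> nat \<Rightarrow> nat" where
  "count_below S x = card {s \<in> S. s < x}"

lemma count_below_Suc:
  assumes "finite S"
  shows "count_below S (Suc x) = count_below S x + (if x \<in> S then 1 else 0)"
proof -
  have "{s \<in> S. s < Suc x} = {s \<in> S. s < x} \<union> (if x \<in> S then {x} else {})"
    by (auto simp: less_Suc_eq)
  then show ?thesis using assms by (auto simp: count_below_def)
qed

text \<open>An interval of \<open>d\<close> positions holds at most \<open>d\<close> deleted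
  strings; this bounds how far two indices can approach each other.\<close>

lemma count_below_add:
  assumes "finite (S :: nat set)"
  shows "count_below S (x + d) \<le> count_below S x + d"
  by (induction d) (use assms in \<open>auto simp: count_below_Suc\<close>)

lemma count_below_transpose:
  assumes "a < x \<longleftrightarrow> b < x"
  shows "count_below (Transposition.transpose a b ` S) x = count_below S x"
proof -
  have "{s \<in> Transposition.transpose a b ` S. s < x} = Transposition.transpose a b ` {s \<in> S. s < x}"
    using assms by (auto simp: Transposition.transpose_def)
  then show ?thesis by (simp add: count_below_def)
qed

lemma count_below_less:
  assumes "S \<subseteq> {1..n}" "1 \<le> x"
  shows "count_below S x < x"
proof -
  have "count_below S x \<le> card {1..<x}"
    unfolding count_below_def using assms by (intro card_mono) auto
  then show ?thesis using assms by simp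
qed

text \<open>Makes a surviving letter a generator of the smaller braid group: \<open>x\<close> and
  \<open>x + 1\<close> hold no deleted string, and at most \<open>n - x - 1\<close> deleted strings
  lie further right.\<close>

lemma count_below_gap:
  assumes "S \<subseteq> {1..n}" "1 \<le> x" "x < n" "x \<notin> S" "x + 1 \<notin> S"
  shows "x - count_below S x < n - card S"
proof -
  have fin: "finite S" using assms(1) finite_subset by blast
  \<comment> \<open>The bound equals \<open>n + 1\<close> and so exceeds every element of
    \<open>S\<close>.\<close>
  have "{s \<in> S. s < x + 2 + (n - x - 1)} = S"
    using assms by auto
  then have "card S \<le> count_below S (x + 2) + (n - x - 1)"
    using count_below_add[OF fin, of "x + 2" "n - x - 1"] by (simp add: count_below_def)
  also have "count_below S (x + 2) = count_below S x"
    using assms(4,5) by (simp add: count_below_Suc fin)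
  finally show ?thesis
    using count_below_less[OF assms(1,2)] assms(2,3) by linarith
qed

text \<open>Takes the place of the defining equation as rewrite rule, so that the shift appears as
  \<open>count_below\<close> and the rules above can evaluate it.\<close>

lemma delete_strings_Cons [simp]:
  "delete_strings S ((i, e) # w) =
     (if i \<in> S \<or> i + 1 \<in> S then [] else [(i - count_below S i, e)]) @
     delete_strings (Transposition.transpose i (i + 1) ` S) w"
  by (simp add: count_below_def)

declare delete_strings.simps(2) [simp del]

lemma delete_strings_in_braid_words:
  assumes "w \<in> braid_words n" "S \<subseteq> {1..n}"
  shows "delete_strings S w \<in> braid_words (n - card S)"
  using assms
proof (induction w arbitrary: S)
  case (Cons x w)
  obtain i e where x: "x = (i, e)" by (cases x)
  have "Transposition.transpose i (i + 1) ` S \<subseteq> {1..n}"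
    using Cons.prems x by (auto simp: Transposition.transpose_def split: if_splits)
  then have "delete_strings (Transposition.transpose i (i + 1) ` S) w \<in> braid_words (n - card S)"
    using Cons.IH[of "Transposition.transpose i (i + 1) ` S"] Cons.prems x by simp
  then show ?case
    using Cons.prems count_below_gap[of S n i] count_below_less[of S n i] by (auto simp: x)
qed auto

text \<open>Deletion is not a homomorphism, since the set of deleted positions moves along the word.
  Each relation still turns into one of the same type at a shifted index, or into two equal
  words.\<close>

lemma delete_strings_invariant:
  assumes "braid_eq n u v" "S \<subseteq> {1..n}"
  shows "braid_eq (n - card S) (delete_strings S u) (delete_strings S v)"
  using assms
proof (induction arbitrary: S rule: braid_eq.induct)
  case (refl w)
  then show ?case by (simp add: delete_strings_in_braid_words braid_eq.refl)
next
  case (sym u v)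
  then show ?case by (simp add: braid_eq.sym)
next
  case (trans u v w)
  then show ?case by (meson braid_eq.trans)
next
  case (append u u' v v')
  have *: "string_perm u' ` S = string_perm u ` S"
    using append.hyps(1) string_perm_invariant by auto
  \<comment> \<open>The second factor starts with the moved set, which has the same size and so
    leads to the same smaller group.\<close>
  have "string_perm u ` S \<subseteq> {1..n}" "card (string_perm u ` S) = card S"
    using append.hyps append.prems braid_eq_in_braid_words string_perm_image_subset
      inj_string_perm[of u] by (blast, simp add: card_image inj_on_subset)
  then have "braid_eq (n - card S) (delete_strings (string_perm u ` S) v)
      (delete_strings (string_perm u ` S) v')"
    using append.IH(2)[of "string_perm u ` S"] by simp
  then show ?case
    using append by (simp add: delete_strings_append * braid_eq.append)
next
  case (cancel i e)
  then have [simp]: "finite S" using finite_subset by blast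
  show ?case
    using cancel count_below_gap[of S n i] count_below_less[of S n i]
    by (auto simp: transpose_image_mem_iff count_below_transpose intro!: braid_eq.refl braid_eq.cancel)
next
  case (commute i j)
  then have [simp]: "finite S" using finite_subset by blast
  \<comment> \<open>Surviving letters stay two apart: no string is deleted at \<open>i\<close> or
    \<open>i + 1\<close>, and the \<open>d\<close> positions from \<open>i + 2\<close> up to
    \<open>j\<close> add at most \<open>d\<close> to the shift.\<close>
  have *: "i - count_below S i + 2 \<le> j - count_below S j" if "i \<notin> S" "i + 1 \<notin> S"
  proof -
    have "count_below S (i + 2) = count_below S i"
      using that by (simp add: count_below_Suc)
    moreover obtain d where "j = i + 2 + d"
      using commute by (metis le_iff_add)
    ultimately show ?thesis
      using count_below_add[of S "i + 2" d] count_below_less[of S n i] commute by simp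
  qed
  have "Transposition.transpose i (i + 1) j = j" "Transposition.transpose i (i + 1) (j + 1) = j + 1"
     "Transposition.transpose j (j + 1) i = i" "Transposition.transpose j (j + 1) (i + 1) = i + 1"
    using commute by (auto simp: Transposition.transpose_def)
  then show ?case
    using commute * count_below_gap[of S n i] count_below_less[of S n i]
       count_below_gap[of S n j] count_below_less[of S n j]
    by (auto simp: transpose_image_mem_iff count_below_transpose
        intro!: braid_eq.refl braid_eq.commute)
next
  case (braid i)
  then have [simp]: "finite S" using finite_subset by blast
  have t: "Transposition.transpose i (Suc i) (i + 2) = i + 2"
    "Transposition.transpose (Suc i) (i + 2) i = i"
    "Transposition.transpose (Suc i) (Suc (Suc i)) i = i"
    "Transposition.transpose i (Suc i) (Suc (Suc i)) = Suc (Suc i)"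
    by (auto simp: Transposition.transpose_def)
  \<comment> \<open>If all three strings survive, all letters are shifted by the same amount and the
    braid relation remains.\<close>
  have "braid_eq (n - card S)
     [(i - c, True), (Suc i - c, True), (i - c, True)]
     [(Suc i - c, True), (i - c, True), (Suc i - c, True)]"
     if "c = count_below S i" "i \<notin> S" "i + 1 \<notin> S" "i + 2 \<notin> S" for c
    using braid_eq.braid[of "i - c" "n - card S"] that count_below_gap[of S n "i + 1"] 
       count_below_less[of S n i] braid by (simp add: Suc_diff_le count_below_Suc less_imp_le)
  \<comment> \<open>If only the middle string is deleted, each side keeps the one crossing of the
    outer strings, with index \<open>i - count_below S i\<close>. That this is a generator is seen
    after the first crossing, when the outer strings are neighbours at \<open>i + 1\<close> and
    \<open>i + 2\<close>.\<close>
  moreover have gap: "i - count_below S i < n - card S" if "i + 1 \<in> S" "i \<notin> S" "i + 2 \<notin> S"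
  proof -
    have "Transposition.transpose i (i + 1) ` S \<subseteq> {1..n}"
      using braid by (auto simp: Transposition.transpose_def)
    then show ?thesis
      using count_below_gap[of "Transposition.transpose i (i + 1) ` S" n "i + 1"] braid that
      by (simp add: transpose_image_mem_iff count_below_transpose count_below_Suc t)
  qed
  ultimately show ?case
    using braid gap count_below_gap[of S n i] count_below_gap[of S n "i + 1"] count_below_less[of S n i]
    by (auto simp: transpose_image_mem_iff count_below_transpose count_below_Suc t
        intro!: braid_eq.refl split: if_splits)
qed

section \<open>Calculus of braid words\<close>

declare braid_eq.trans [trans]

lemma braid_eq_context:
  assumes "braid_eq n u v" "a \<in> braid_words n" "b \<in> braid_words n"
  shows "braid_eq n (a @ u @ b) (a @ v @ b)"
  using assms by (intro braid_eq.append braid_eq.refl)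

lemma braid_eq_left:
  assumes "braid_eq n u v" "a \<in> braid_words n"
  shows "braid_eq n (a @ u) (a @ v)"
  using assms by (intro braid_eq.append braid_eq.refl)

lemma braid_eq_right:
  assumes "braid_eq n u v" "b \<in> braid_words n"
  shows "braid_eq n (u @ b) (v @ b)"
  using assms by (intro braid_eq.append braid_eq.refl)

lemma word_inv_involutive [simp]: "word_inv (word_inv w) = w"
  by (induction w) (auto simp: word_inv_def rev_map)

lemma word_inv_append: "word_inv (u @ v) = word_inv v @ word_inv u"
  by (simp add: word_inv_def)

lemma braid_eq_inv_right: "w \<in> braid_words n \<Longrightarrow> braid_eq n (w @ word_inv w) []"
  using braid_eq_inv_left[of "word_inv w" n] by simp

lemma braid_eq_cancel_left:
  assumes "braid_eq n (a @ u) (a @ v)"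
  shows "braid_eq n u v"
proof -
  have w: "a \<in> braid_words n" "u \<in> braid_words n" "v \<in> braid_words n"
    using braid_eq_in_braid_words[OF assms] by auto
  have *: "braid_eq n (word_inv a @ a @ x) x" if "x \<in> braid_words n" for x
    using braid_eq_right[OF braid_eq_inv_left[OF w(1)] that] by simp
  have "braid_eq n u (word_inv a @ a @ u)"
    using * w(2) by (blast intro: braid_eq.sym)
  also have "braid_eq n \<dots> (word_inv a @ a @ v)"
    using braid_eq_left[OF assms, of "word_inv a"] w by simp
  also have "braid_eq n \<dots> v"
    using * w(3) by blast
  finally show ?thesis .
qed

lemma braid_eq_move_left:
  assumes "braid_eq n (a @ u) v"
  shows "braid_eq n u (word_inv a @ v)"
proof -
  have w: "a \<in> braid_words n" "v \<in> braid_words n"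
    using braid_eq_in_braid_words[OF assms] by auto
  have "braid_eq n v (a @ word_inv a @ v)"
    using braid_eq_right[OF braid_eq_inv_right[OF w(1)] w(2)] by (simp add: braid_eq.sym)
  with assms show ?thesis
    by (blast intro: braid_eq_cancel_left braid_eq.trans)
qed

lemma braid_eq_move_right:
  assumes "braid_eq n (u @ a) v"
  shows "braid_eq n u (v @ word_inv a)"
proof -
  have w: "a \<in> braid_words n" "u \<in> braid_words n"
    using braid_eq_in_braid_words[OF assms] by auto
  have "braid_eq n u (u @ a @ word_inv a)"
    using braid_eq_left[OF braid_eq_inv_right[OF w(1)] w(2)] by (simp add: braid_eq.sym)
  also have "braid_eq n \<dots> (v @ word_inv a)"
    using braid_eq_right[OF assms, of "word_inv a"] w by simp
  finally show ?thesis .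
qed

lemma braid_of_eq_braid_of_iff:
  assumes "v \<in> braid_words n"
  shows "braid_of n u = braid_of n v \<longleftrightarrow> braid_eq n u v"
  using assms by (metis braid_eq.sym braid_of_eq_iff)

lemma positive_words_subset: "positive_words n \<subseteq> braid_words n"
  by (auto simp: positive_words_def braid_words_def)

lemma positive_words_simps [simp]:
  "[] \<in> positive_words n"
  "u @ v \<in> positive_words n \<longleftrightarrow> u \<in> positive_words n \<and> v \<in> positive_words n"
  "(i, e) # v \<in> positive_words n \<longleftrightarrow> 1 \<le> i \<and> i < n \<and> e \<and> v \<in> positive_words n"
  by (auto simp: positive_words_def)

section \<open>Existence and uniqueness of the normal form\<close>

definition pos_run :: "nat \<Rightarrow> braid_word" where
  "pos_run m = map (\<lambda>i. (i, True)) [1..<Suc m]"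

lemma pos_run_0 [simp]: "pos_run 0 = []"
  by (simp add: pos_run_def)

lemma pos_run_Suc: "pos_run (Suc m) = pos_run m @ [(Suc m, True)]"
  by (simp add: pos_run_def)

lemma Delta_0 [simp]: "Delta 0 = []"
  by (simp add: Delta_def)

text \<open>The inductions on \<open>Delta\<close> follow this recursion, with
  \<open>Delta m\<close> for \<open>m \<le> n\<close> regarded as a braid on all \<open>n\<close>
  strings.\<close>

lemma Delta_Suc: "Delta (Suc m) = pos_run m @ Delta m"
  by (cases m) (simp_all add: Delta_def pos_run_def)

lemma pos_run_positive: "m < n \<Longrightarrow> pos_run m \<in> positive_words n"
  by (auto simp: pos_run_def positive_words_def)

lemma Delta_positive: "m \<le> n \<Longrightarrow> Delta m \<in> positive_words n"
  by (induction m) (auto simp: Delta_Suc pos_run_positive)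

lemma pos_run_words [simp]: "m < n \<Longrightarrow> pos_run m \<in> braid_words n"
  using pos_run_positive positive_words_subset by blast

lemma Delta_words [simp]: "m \<le> n \<Longrightarrow> Delta m \<in> braid_words n"
  using Delta_positive positive_words_subset by blast

text \<open>All letters of \<open>w\<close> have index at most \<open>m - 1\<close>, hence differ
  from \<open>j\<close> by at least two.\<close>

lemma positive_commutes:
  assumes "w \<in> positive_words m" "Suc m \<le> j" "j < n"
  shows "braid_eq n (w @ [(j, True)]) ((j, True) # w)"
  using assms(1)
proof (induction w)
  case Nil
  then show ?case using assms by (simp add: braid_eq.refl)
next
  case (Cons x w)
  obtain i where x: "x = (i, True)" "1 \<le> i" "i < m"
    using Cons.prems by (cases x) auto
  have w: "w \<in> positive_words m" using Cons.prems x by simp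
  then have w': "w \<in> braid_words n"
    using assms by (auto simp: positive_words_def braid_words_def)
  have "braid_eq n ([(i, True)] @ w @ [(j, True)]) ([(i, True)] @ (j, True) # w)"
    using Cons.IH[OF w] by (rule braid_eq_left) (use x assms in simp)
  also have "braid_eq n \<dots> ([(j, True)] @ [(i, True)] @ w)"
    using braid_eq_right[OF braid_eq.commute[of i j n] w'] x assms by simp
  finally show ?case by (simp add: x)
qed

text \<open>The letter \<open>i\<close> passes the letters from \<open>i + 2\<close> on, undergoes
  one braid relation with the letters \<open>i\<close>, \<open>i + 1\<close> of the run, and comes
  out as \<open>i + 1\<close>, which passes the letters below \<open>i\<close>.\<close>

lemma pos_run_shift:
  assumes "m < n" "1 \<le> i" "i < m"
  shows "braid_eq n (pos_run m @ [(i, True)]) ((Suc i, True) # pos_run m)"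
  using assms
proof (induction m)
  case (Suc m)
  show ?case
  proof (cases "i < m")
    case True
    have "braid_eq n (pos_run m @ [(Suc m, True), (i, True)] @ []) (pos_run m @ [(i, True), (Suc m, True)] @ [])"
      using Suc.prems True by (intro braid_eq_context braid_eq.sym[OF braid_eq.commute]) auto
    also have "braid_eq n \<dots> (((Suc i, True) # pos_run m) @ [(Suc m, True)])"
      using braid_eq_right[OF Suc.IH, of "[(Suc m, True)]"] Suc.prems True by simp
    finally show ?thesis by (simp add: pos_run_Suc)
  next
    case False
    then have "i = m" using Suc.prems by simp
    then obtain l where l: "m = Suc l" "i = Suc l" using Suc.prems by (cases m) auto
    have "braid_eq n (pos_run l @ [(i, True), (i + 1, True), (i, True)] @ [])
        (pos_run l @ [(i + 1, True), (i, True), (i + 1, True)] @ [])"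
      using Suc.prems l by (intro braid_eq_context braid_eq.braid) auto
    also have "braid_eq n \<dots> (((Suc i, True) # pos_run l) @ [(i, True), (i + 1, True)])"
      using braid_eq_right[OF positive_commutes[of "pos_run l" i "Suc i" n], of "[(i, True), (i + 1, True)]"]
        Suc.prems l by (simp add: pos_run_positive)
    finally show ?thesis by (simp add: pos_run_Suc l)
  qed
qed simp

text \<open>Moving the short run leftwards through the long one raises its indices to
  \<open>2, ..., m + 1\<close>, and the leading letter \<open>1\<close> completes them to a second
  long run.\<close>

lemma pos_run_square:
  assumes "Suc m < n"
  shows "braid_eq n (pos_run (Suc m) @ pos_run (Suc m)) ((1, True) # pos_run (Suc m) @ pos_run m)"
proof -
  \<comment> \<open>Only the first \<open>k\<close> letters of the short run are moved;
    \<open>k = m\<close> is the claim.\<close>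
  have "braid_eq n ((1, True) # pos_run (Suc m) @ pos_run k) (pos_run (Suc k) @ pos_run (Suc m))"
    if "k \<le> m" for k
    using that
  proof (induction k)
    case 0
    then show ?case using assms by (simp add: pos_run_Suc braid_eq.refl)
  next
    case (Suc k)
    have "braid_eq n (((1, True) # pos_run (Suc m) @ pos_run k) @ [(Suc k, True)])
        ((pos_run (Suc k) @ pos_run (Suc m)) @ [(Suc k, True)])"
      using Suc assms by (intro braid_eq_right) auto
    also have "braid_eq n \<dots> (pos_run (Suc k) @ (Suc (Suc k), True) # pos_run (Suc m))"
      using braid_eq_left[OF pos_run_shift[of "Suc m" n "Suc k"], of "pos_run (Suc k)"] Suc assms
      by simp
    finally show ?case by (simp add: pos_run_Suc)
  qed
  then show ?thesis by (blast intro: braid_eq.sym)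
qed

text \<open>In the step to \<open>Suc m\<close>, \<open>Delta m\<close> turns \<open>i < m\<close>
  into \<open>m - i\<close> and the new run raises it by one. The top index \<open>i = m\<close>
  passes the inner \<open>Delta\<close>, completes the second run, and \<open>pos_run_square\<close>
  produces the letter \<open>1\<close>.\<close>

lemma Delta_conjugation:
  assumes "m \<le> n" "1 \<le> i" "i < m"
  shows "braid_eq n (Delta m @ [(i, True)]) ((m - i, True) # Delta m)"
  using assms
proof (induction m)
  case (Suc m)
  show ?case
  proof (cases "i < m")
    case True
    have "braid_eq n (pos_run m @ Delta m @ [(i, True)]) (pos_run m @ (m - i, True) # Delta m)"
      using Suc True by (intro braid_eq_left) auto
    also have "braid_eq n \<dots> (((Suc (m - i), True) # pos_run m) @ Delta m)"
      using braid_eq_right[OF pos_run_shift[of m n "m - i"], of "Delta m"] Suc.prems True by simp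
    finally show ?thesis using True by (simp add: Delta_Suc Suc_diff_le)
  next
    case False
    then have "i = m" using Suc.prems by simp
    then obtain l where l: "m = Suc l" "i = Suc l" using Suc.prems by (cases m) auto
    have "braid_eq n ((pos_run (Suc l) @ pos_run l) @ Delta l @ [(Suc l, True)])
        ((pos_run (Suc l) @ pos_run l) @ (Suc l, True) # Delta l)"
      using Suc.prems l by (intro braid_eq_left positive_commutes[OF Delta_positive[of l l]]) auto
    also have "braid_eq n \<dots> (((1, True) # pos_run (Suc l) @ pos_run l) @ Delta l)"
      using braid_eq_right[OF pos_run_square[of l n], of "Delta l"] Suc.prems l
      by (simp add: pos_run_Suc)
    finally show ?thesis by (simp add: Delta_Suc l)
  qed
qed simp

lemma Delta_ends_with:
  assumes "m \<le> n" "1 \<le> i" "i < m"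
  shows "\<exists>u\<in>positive_words n. braid_eq n (Delta m) (u @ [(i, True)])"
  using assms
proof (induction m)
  case (Suc m)
  show ?case
  proof (cases "i < m")
    case True
    then obtain u where u: "u \<in> positive_words n" "braid_eq n (Delta m) (u @ [(i, True)])"
      using Suc by auto
    then have "braid_eq n (Delta (Suc m)) ((pos_run m @ u) @ [(i, True)])"
      using braid_eq_left[of n _ _ "pos_run m"] Suc.prems by (simp add: Delta_Suc)
    then show ?thesis using u Suc.prems by (intro bexI[of _ "pos_run m @ u"]) (auto simp: pos_run_positive)
  next
    case False
    then have i: "i = m" "1 \<le> m" using Suc.prems by auto
    define u where "u = tl (pos_run m) @ Delta m"
    have "pos_run m = (1, True) # tl (pos_run m)"
      using i by (simp add: pos_run_def upt_rec)
    then have D: "Delta (Suc m) = (1, True) # u"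
      by (simp add: u_def Delta_Suc)
    then have u: "u \<in> positive_words n"
      using Delta_positive[of "Suc m" n] Suc.prems by simp
    \<comment> \<open>Conjugation turns the top index into \<open>1\<close>, which is also the first
      letter of \<open>Delta (Suc m)\<close>; cancelling it on the left gives the
      factorization.\<close>
    have "braid_eq n ([(1, True)] @ u @ [(i, True)]) ([(1, True)] @ Delta (Suc m))"
      using Delta_conjugation[of "Suc m" n i] Suc.prems i D by simp
    then have "braid_eq n (Delta (Suc m)) (u @ [(i, True)])"
      by (blast intro: braid_eq_cancel_left braid_eq.sym)
    then show ?thesis using u by blast
  qed
qed simp

text \<open>Conjugation by \<open>Delta n\<close> reflects each index \<open>i\<close> to
  \<open>n - i\<close>, which keeps the word positive.\<close>

lemma positive_past_inv_Delta:
  assumes "u \<in> positive_words n"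
  shows "\<exists>u'\<in>positive_words n. braid_eq n (u @ word_inv (Delta n)) (word_inv (Delta n) @ u')"
  using assms
proof (induction u)
  case Nil
  then show ?case by (auto intro!: braid_eq.refl bexI[of _ "[]"])
next
  case (Cons x u)
  obtain i where x: "x = (i, True)" "1 \<le> i" "i < n"
    using Cons.prems by (cases x) auto
  obtain u' where u': "u' \<in> positive_words n"
    "braid_eq n (u @ word_inv (Delta n)) (word_inv (Delta n) @ u')"
    using Cons x by auto
  have w: "u' \<in> braid_words n" using u' positive_words_subset by blast
  have "braid_eq n (Delta n @ [(n - (n - i), True)]) ((n - i, True) # Delta n)" 
    using Delta_conjugation[of n n i] x by simp
  then have "braid_eq n (Delta n @ ([(i, True)] @ word_inv (Delta n))) [(n - i, True)]"
    using braid_eq_move_right[OF braid_eq.sym, of n "Delta n @ [(i, True)]" "[(n - i, True)]" "Delta n"] x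
    by (simp add: braid_eq.sym)
  then have *: "braid_eq n ([(i, True)] @ word_inv (Delta n)) (word_inv (Delta n) @ [(n - i, True)])"
    by (rule braid_eq_move_left)
  have "braid_eq n ([(i, True)] @ u @ word_inv (Delta n)) ([(i, True)] @ word_inv (Delta n) @ u')"
    using u' x by (intro braid_eq_left) auto
  also have "braid_eq n \<dots> (word_inv (Delta n) @ (n - i, True) # u')"
    using braid_eq_right[OF * w] by simp
  finally show ?case
    using u' x by (intro bexI[of _ "(n - i, True) # u'"]) auto
qed

lemma Delta_neg_power_words [simp]: "Delta_neg_power n r \<in> braid_words n"
  by (induction r) (auto simp: Delta_neg_power_def)

lemma Delta_neg_power_Suc: "Delta_neg_power n (Suc r) = Delta_neg_power n r @ word_inv (Delta n)"
  by (induction r) (simp_all add: Delta_neg_power_def)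

lemma braid_eq_Delta_neg_power:
  assumes "v \<in> braid_words n"
  shows "\<exists>r. \<exists>u\<in>positive_words n. braid_eq n v (Delta_neg_power n r @ u)"
  using assms
proof (induction v rule: rev_induct)
  case Nil
  then show ?case
    by (auto simp: Delta_neg_power_def intro!: braid_eq.refl exI[of _ 0] bexI[of _ "[]"])
next
  case (snoc x v)
  obtain i e where x: "x = (i, e)" "1 \<le> i" "i < n"
    using snoc.prems by (cases x) auto
  obtain r u where u: "u \<in> positive_words n" "braid_eq n v (Delta_neg_power n r @ u)"
    using snoc by auto
  have uw: "u \<in> braid_words n" using u positive_words_subset by blast
  have vx: "braid_eq n (v @ [x]) (Delta_neg_power n r @ u @ [x])"
    using braid_eq_right[OF u(2), of "[x]"] x by simp
  show ?case
  proof (cases e)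
    case True
    then show ?thesis using vx u x by (intro exI[of _ r] bexI[of _ "u @ [x]"]) auto
  next
    case False
    \<comment> \<open>With \<open>Delta n\<close> equal to \<open>a\<close> times the letter
      \<open>i\<close>, the inverse letter is the inverse of \<open>Delta n\<close> times
      \<open>a\<close>; that inverse then moves left across \<open>u\<close>.\<close>
    obtain a where a: "a \<in> positive_words n" "braid_eq n (Delta n) (a @ [(i, True)])"
      using Delta_ends_with[of n n i] x by auto
    have aw: "a \<in> braid_words n" using a positive_words_subset by blast
    have "braid_eq n a (Delta n @ [x])"
      using braid_eq_move_right[OF braid_eq.sym[OF a(2)]] False x by (simp add: word_inv_def)
    then have xa: "braid_eq n [x] (word_inv (Delta n) @ a)"
      by (blast intro: braid_eq_move_left braid_eq.sym)
    obtain u' where u': "u' \<in> positive_words n"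
      "braid_eq n (u @ word_inv (Delta n)) (word_inv (Delta n) @ u')"
      using positive_past_inv_Delta u by blast
    have "braid_eq n (Delta_neg_power n r @ u @ [x]) (Delta_neg_power n r @ u @ word_inv (Delta n) @ a)"
      using braid_eq_left[OF xa, of "Delta_neg_power n r @ u"] uw by simp
    also have "braid_eq n \<dots> (Delta_neg_power n r @ (word_inv (Delta n) @ u') @ a)"
      using braid_eq_context[OF u'(2), of "Delta_neg_power n r" a] aw by simp
    finally have "braid_eq n (v @ [x]) (Delta_neg_power n (Suc r) @ (u' @ a))"
      using vx by (auto simp: Delta_neg_power_Suc intro: braid_eq.trans)
    then show ?thesis using u' a by (intro exI[of _ "Suc r"] bexI[of _ "u' @ a"]) auto
  qed
qed

section \<open>Degree, and selection of the lexicographically least word\<close>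

lemma degree_append: "degree (u @ v) = degree u + degree v"
  by (simp add: degree_def)

lemma degree_invariant: "braid_eq n u v \<Longrightarrow> degree u = degree v"
  by (induction rule: braid_eq.induct) (auto simp: degree_append, auto simp: degree_def)

lemma degree_positive: "w \<in> positive_words n \<Longrightarrow> degree w = int (length w)"
  by (induction w) (auto simp: degree_def positive_words_def)

text \<open>The lexicographic comparison sees only the indices; on positive words this loses
  nothing.\<close>

lemma positive_word_eq_iff:
  assumes "u \<in> positive_words n" "v \<in> positive_words n"
  shows "u = v \<longleftrightarrow> map fst u = map fst v"
proof -
  have "w = map (\<lambda>i. (i, True)) (map fst w)" if "w \<in> positive_words n" for w
    using that by (induction w) auto
  then show ?thesis using assms by metis
qed

text \<open>All these words have length \<open>degree v\<close>. Finiteness supplies a least one,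
  although the lexicographic order on words is not a well-order in general.\<close>

lemma finite_braid_eq_positive: "finite {u \<in> positive_words n. braid_eq n u v}"
proof (rule finite_subset)
  show "{u \<in> positive_words n. braid_eq n u v} \<subseteq>
      {u. set u \<subseteq> {1..<n} \<times> {True} \<and> length u = nat (degree v)}"
    using degree_positive degree_invariant by (fastforce simp: positive_words_def)
qed (simp add: finite_lists_length_eq)

lemma normal_form_ex:
  assumes v: "v \<in> braid_words n"
  shows "\<exists>u. normal_form n u \<and> braid_of n u = braid_of n v"
proof -
  define P where "P r \<longleftrightarrow> (\<exists>u\<in>positive_words n. braid_of n (Delta_neg_power n r @ u) = braid_of n v)" for r
  have "\<exists>r. P r"
    using braid_eq_Delta_neg_power[OF v] v
    unfolding P_def by (metis braid_of_eq_iff)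
  then have r: "P (LEAST r. P r)" "\<forall>s<(LEAST r. P r). \<not> P s"
    by (auto intro: LeastI_ex dest: not_less_Least)
  then obtain r where r: "P r" "\<forall>s<r. \<not> P s" by blast
  then obtain u where u: "u \<in> positive_words n" "braid_of n (Delta_neg_power n r @ u) = braid_of n v"
    by (auto simp: P_def)
  define A where "A = {x \<in> positive_words n. braid_eq n x u}"
  have "u \<in> A" using u positive_words_subset[of n] by (auto simp: A_def braid_eq.refl)
  then have "Min (map fst ` A) \<in> map fst ` A" "\<And>x. x \<in> A \<Longrightarrow> Min (map fst ` A) \<le> map fst x"
    using finite_braid_eq_positive[of n u] by (auto simp: A_def intro!: Min_in Min_le)
  then obtain m where m: "m \<in> A" "\<And>x. x \<in> A \<Longrightarrow> map fst m \<le> map fst x" by auto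
  have mu: "braid_eq n m u" "m \<in> positive_words n" using m by (auto simp: A_def)
  have "braid_eq n (Delta_neg_power n r @ m) (Delta_neg_power n r @ u)"
    using mu by (intro braid_eq_left) auto
  then have mv: "braid_of n (Delta_neg_power n r @ m) = braid_of n v"
    using u(2) by (metis braid_eq_in_braid_words braid_of_eq_iff)
  have "map fst m \<le> map fst x" if "x \<in> positive_words n" "braid_of n x = braid_of n m" for x
  proof (rule m(2))
    have "braid_eq n x m"
      using that positive_words_subset braid_of_eq_iff by blast
    then show "x \<in> A" using that mu by (auto simp: A_def intro: braid_eq.trans)
  qed
  then have "normal_form n (Delta_neg_power n r @ m)"
    using r(2) mu mv unfolding normal_form_def P_def by metis
  then show ?thesis using mv by blast
qed

lemma normal_form_in_braid_words: "normal_form n u \<Longrightarrow> u \<in> braid_words n"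
  using positive_words_subset[of n] by (auto simp: normal_form_def)

text \<open>Each exponent is minimal for the common braid, so they agree and the powers cancel; the
  positive parts then represent one braid and are both least for it.\<close>

lemma normal_form_unique:
  assumes u: "normal_form n u" and v: "normal_form n v" and eq: "braid_of n u = braid_of n v"
  shows "u = v"
proof -
  obtain r a where a: "a \<in> positive_words n" "u = Delta_neg_power n r @ a"
     "\<forall>s<r. \<not> (\<exists>x\<in>positive_words n. braid_of n (Delta_neg_power n s @ x) = braid_of n u)"
     "\<forall>x\<in>positive_words n. braid_of n x = braid_of n a \<longrightarrow> map fst a \<le> map fst x"
    using u unfolding normal_form_def by blast
  obtain s b where b: "b \<in> positive_words n" "v = Delta_neg_power n s @ b"
     "\<forall>r<s. \<not> (\<exists>x\<in>positive_words n. braid_of n (Delta_neg_power n r @ x) = braid_of n v)"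
     "\<forall>x\<in>positive_words n. braid_of n x = braid_of n b \<longrightarrow> map fst b \<le> map fst x"
    using v unfolding normal_form_def by blast
  have rs: "r = s"
    using a b eq by (metis linorder_neqE_nat)
  have "braid_eq n u v"
    using eq braid_of_eq_iff normal_form_in_braid_words[OF u] by blast
  then have "braid_eq n a b"
    using a(2) b(2) rs braid_eq_cancel_left by blast
  then have "braid_of n a = braid_of n b"
    by (metis braid_eq_in_braid_words braid_of_eq_iff)
  then have "map fst a = map fst b"
    using a(1,4) b(1,4) by (metis order_antisym)
  then show ?thesis using a b rs positive_word_eq_iff by metis
qed

text \<open>Justifies the definite description in \<open>Normalize\<close>.\<close>

lemma Normalize:
  assumes "v \<in> braid_words n"
  shows "normal_form n (Normalize n v)" "braid_eq n (Normalize n v) v"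
proof -
  have "\<exists>!u. normal_form n u \<and> braid_of n u = braid_of n v"
    using normal_form_ex[OF assms] normal_form_unique by metis
  then have *: "normal_form n (Normalize n v) \<and> braid_of n (Normalize n v) = braid_of n v"
    unfolding Normalize_def by (rule theI')
  then show "normal_form n (Normalize n v)" "braid_eq n (Normalize n v) v"
    using braid_of_eq_iff normal_form_in_braid_words by blast+
qed

section \<open>Half-twist powers pass the tests\<close>

lemma inv_braid_of:
  assumes "w \<in> braid_words n"
  shows "inv\<^bsub>braid_group n\<^esub> (braid_of n w) = braid_of n (word_inv w)"
proof -
  interpret group "braid_group n" by (rule group_braid_group)
  have "braid_of n (word_inv w) \<otimes>\<^bsub>braid_group n\<^esub> braid_of n w = \<one>\<^bsub>braid_group n\<^esub>"
    using assms braid_eq_inv_left[OF assms] braid_of_eq_iff[of "word_inv w @ w" n "[]"]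
    by (simp add: braid_group_mult) (simp add: braid_group_def)
  then show ?thesis
    using assms by (intro inv_equality) (auto simp: braid_group_def)
qed

lemma replicate_in_positive_words [simp]:
  "1 \<le> j \<Longrightarrow> j < n \<Longrightarrow> replicate m (j, True) \<in> positive_words n"
  by (induction m) auto

lemma replicate_in_braid_words [simp]:
  "1 \<le> j \<Longrightarrow> j < n \<Longrightarrow> replicate m (j, e) \<in> braid_words n"
  by (induction m) auto

text \<open>Telescoping: \<open>word_inv h @ h\<close> cancels between consecutive factors. The
  instance \<open>h = []\<close> gives the powers of a generator.\<close>

lemma braid_of_conjugate_pow:
  assumes "h \<in> braid_words n" "1 \<le> j" "j < n"
  shows "braid_of n (h @ [(j, True)] @ word_inv h) [^]\<^bsub>braid_group n\<^esub> m =
    braid_of n (h @ replicate m (j, True) @ word_inv h)"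
proof (induction m)
  case 0
  have "braid_of n [] = braid_of n (h @ word_inv h)"
    using assms braid_eq_inv_right by (subst braid_of_eq_iff) (auto intro: braid_eq.sym)
  then show ?case by (simp add: braid_group_def nat_pow_def)
next
  case (Suc m)
  interpret group "braid_group n" by (rule group_braid_group)
  have "braid_eq n ((h @ replicate m (j, True)) @ (word_inv h @ h) @ ([(j, True)] @ word_inv h))
     ((h @ replicate m (j, True)) @ [] @ ([(j, True)] @ word_inv h))"
    using assms braid_eq_inv_left by (intro braid_eq_context) auto
  then have "braid_of n ((h @ replicate m (j, True) @ word_inv h) @ (h @ [(j, True)] @ word_inv h)) =
     braid_of n (h @ replicate (Suc m) (j, True) @ word_inv h)"
    using assms by (subst braid_of_eq_iff) (auto simp: replicate_app_Cons_same)
  moreover have "braid_of n (h @ replicate m (j, True) @ word_inv h)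
      \<otimes>\<^bsub>braid_group n\<^esub> braid_of n (h @ [(j, True)] @ word_inv h) =
     braid_of n ((h @ replicate m (j, True) @ word_inv h) @ (h @ [(j, True)] @ word_inv h))"
    using assms by (intro braid_group_mult) auto
  ultimately show ?case using Suc by (simp add: nat_pow_Suc)
qed

lemma half_twist_power_word:
  assumes "n \<ge> 2" "half_twist_power n k (braid_of n v)"
  obtains h where "h \<in> braid_words n" "braid_eq n v (h @ replicate k (1, True) @ word_inv h)"
proof -
  obtain b where b: "half_twist n b" "braid_of n v = b [^]\<^bsub>braid_group n\<^esub> k"
    using assms by (auto simp: half_twist_power_def)
  obtain h where h: "h \<in> braid_words n"
     "b = braid_of n h \<otimes>\<^bsub>braid_group n\<^esub> braid_of n [(1, True)] \<otimes>\<^bsub>braid_group n\<^esub> inv\<^bsub>braid_group n\<^esub> (braid_of n h)"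
    using b(1) by (auto simp: half_twist_def braid_group_def)
  have "b = braid_of n (h @ [(1, True)] @ word_inv h)"
    using h assms by (simp add: inv_braid_of braid_group_mult)
  then have "braid_of n v = braid_of n (h @ replicate k (1, True) @ word_inv h)"
    using b(2) braid_of_conjugate_pow[of h n 1 k] h assms by simp
  then have "braid_eq n v (h @ replicate k (1, True) @ word_inv h)"
    by (subst (asm) braid_of_eq_braid_of_iff) (use h assms in auto)
  with h show ?thesis using that by blast
qed

text \<open>The conjugator of \<open>v\<close> is extended by \<open>word_inv r\<close> on the
  left.\<close>

lemma half_twist_power_conjugate:
  assumes "half_twist_power n k (braid_of n v)" "v \<in> braid_words n" "r \<in> braid_words n" "n \<ge> 2"
    and "braid_eq n u (word_inv r @ v @ r)"
  shows "half_twist_power n k (braid_of n u)"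
proof -
  obtain h where h: "h \<in> braid_words n" "braid_eq n v (h @ replicate k (1, True) @ word_inv h)"
    using half_twist_power_word assms by blast
  let ?g = "word_inv r @ h"
  have g: "?g \<in> braid_words n" using h assms by simp
  have "braid_eq n u (word_inv r @ v @ r)" by fact
  also have "braid_eq n \<dots> (word_inv r @ (h @ replicate k (1, True) @ word_inv h) @ r)"
    using h assms by (intro braid_eq_context) auto
  finally have "braid_eq n u (?g @ replicate k (1, True) @ word_inv ?g)"
    by (simp add: word_inv_append)
  then have "braid_of n u = braid_of n (?g @ [(1, True)] @ word_inv ?g) [^]\<^bsub>braid_group n\<^esub> k"
    using braid_of_conjugate_pow[OF g, of 1 k] assms(4) braid_eq_in_braid_words braid_of_eq_iff
    by fastforce
  moreover have "half_twist n (braid_of n (?g @ [(1, True)] @ word_inv ?g))"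
    unfolding half_twist_def using g assms(4)
    by (intro bexI[of _ "braid_of n ?g"])
      (simp add: inv_braid_of braid_group_mult, simp add: braid_group_def)
  ultimately show ?thesis by (auto simp: half_twist_power_def)
qed

section \<open>The invariants of a half-twist power\<close>

lemma string_perm_word_inv:
  assumes "w \<in> braid_words n"
  shows "string_perm (word_inv w) (string_perm w s) = s"
    and "string_perm w (string_perm (word_inv w) s) = s"
  using string_perm_invariant[OF braid_eq_inv_right[OF assms], of s]
    string_perm_invariant[OF braid_eq_inv_left[OF assms], of s]
  by (simp_all add: string_perm_append)

lemma string_perm_replicate:
  "string_perm (replicate k (j, e)) s = (if even k then s else Transposition.transpose j (Suc j) s)"
  by (induction k arbitrary: s) auto

lemma crossings_replicate:
  "crossings (replicate k (j, True)) a b = (if {a, b} = {j, Suc j} then int k else 0)"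
  by (induction k arbitrary: a b) (auto simp: transpose_doubleton_eq_iff insert_commute)

lemma delete_strings_replicate: "delete_strings {j, Suc j} (replicate k (j, e)) = []"
  by (induction k) (auto simp: insert_commute)

text \<open>Here \<open>a\<close> and \<open>b\<close> are the strings that \<open>h\<close> brings
  to the positions \<open>1\<close> and \<open>2\<close>. Without them the middle power disappears
  and the outer parts cancel.\<close>

lemma delete_strings_half_twist_power:
  assumes n: "n \<ge> 2" and h: "h \<in> braid_words n"
    and v: "braid_eq n v (h @ replicate k (1, True) @ word_inv h)"
    and ab: "{string_perm h a, string_perm h b} = {1, 2}" "{a, b} \<subseteq> {1..n}"
  shows "braid_of (n - 2) (delete_strings {a, b} v) = \<one>\<^bsub>braid_group (n - 2)\<^esub>"
proof -
  have im: "string_perm h ` {a, b} = {1, 2}" using ab by simp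
  have "a \<noteq> b" using ab by auto
  then have c: "card {a, b} = 2" by simp
  \<comment> \<open>The middle power preserves the set \<open>{1, 2}\<close>, so
    \<open>word_inv h\<close> loses the same strings whether or not that power stands before
    it.\<close>
  have im2: "string_perm (replicate k (1, True)) ` {1, 2} = {1, 2}"
    by (auto simp: string_perm_replicate numeral_2_eq_2)
  have "delete_strings {1, 2} (replicate k (1, True)) = []"
    using delete_strings_replicate[of 1 k True] by (simp add: numeral_2_eq_2)
  then have "delete_strings {a, b} (h @ replicate k (1, True) @ word_inv h) =
      delete_strings {a, b} (h @ word_inv h)"
    unfolding delete_strings_append im im2 by simp
  then have "braid_eq (n - 2) (delete_strings {a, b} v) (delete_strings {a, b} (h @ word_inv h))"
    using delete_strings_invariant[OF v ab(2)] c by simp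
  moreover have "braid_eq (n - 2) (delete_strings {a, b} (h @ word_inv h)) []"
    using delete_strings_invariant[OF braid_eq_inv_right[OF h] ab(2)] c by simp
  ultimately have "braid_eq (n - 2) (delete_strings {a, b} v) []"
    by (rule braid_eq.trans)
  then show ?thesis
    by (simp add: braid_group_def braid_of_eq_braid_of_iff)
qed

lemma half_twist_power_passes_tests:
  assumes n: "n \<ge> 2" and k: "k \<ge> 1" and v: "half_twist_power n k (braid_of n v)"
  shows "passes_tests n k v"
proof -
  obtain h where h: "h \<in> braid_words n" and vh: "braid_eq n v (h @ replicate k (1, True) @ word_inv h)"
    using half_twist_power_word n v by blast
  define H H' where "H = string_perm h" and "H' = string_perm (word_inv h)"
  have HH: "H' (H s) = s" "H (H' s) = s" for s
    using string_perm_word_inv[OF h] by (simp_all add: H_def H'_def)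
  have "H' ` {1, 2} \<subseteq> {1..n}"
    unfolding H'_def using h n by (intro string_perm_image_subset) auto
  moreover have "H' 1 \<noteq> H' 2" using HH(2) by (metis num.distinct(1) numeral_eq_one_iff)
  \<comment> \<open>The strings that \<open>h\<close> brings to the positions \<open>1\<close> and
    \<open>2\<close>, named in increasing order.\<close>
  ultimately obtain a b where ab: "1 \<le> a" "a < b" "b \<le> n" "{a, b} = {H' 1, H' 2}"
  proof (cases "H' 1 < H' 2")
    case True
    then show ?thesis
      using that[of "H' 1" "H' 2"] \<open>H' ` {1, 2} \<subseteq> {1..n}\<close> by auto
  next
    case False
    then show ?thesis
      using that[of "H' 2" "H' 1"] \<open>H' ` {1, 2} \<subseteq> {1..n}\<close> \<open>H' 1 \<noteq> H' 2\<close>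
      by (auto simp: insert_commute)
  qed
  have pre: "{H x, H y} = {1, 2} \<longleftrightarrow> {x, y} = {a, b}" for x y
  proof -
    have "H z = c \<longleftrightarrow> z = H' c" for z c using HH by metis
    then show ?thesis unfolding ab(4) by (simp add: doubleton_eq_iff)
  qed
  have del: "braid_of (n - 2) (delete_strings {a, b} v) = \<one>\<^bsub>braid_group (n - 2)\<^esub>"
    using delete_strings_half_twist_power[OF n h vh, of a b] pre[of a b] ab(1-3) by (simp add: H_def)
  have perm: "string_perm v s = H' (if even k then H s else Transposition.transpose 1 2 (H s))" for s
    using string_perm_invariant[OF vh, of s]
    by (simp add: string_perm_append string_perm_replicate H_def H'_def numeral_2_eq_2)
  show ?thesis
  proof (cases "even k")
    case True
    \<comment> \<open>For even \<open>k\<close> the middle power fixes every position, so two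
      strings enter \<open>word_inv h\<close> where they left \<open>h\<close>, and the crossings in
      the outer parts cancel.\<close>
    have inv: "crossings (word_inv h) (H x) (H y) = - crossings h x y" for x y
      using crossings_invariant[OF braid_eq_inv_right[OF h], of x y]
      by (simp add: crossings_append flip: H_def)
    have "crossings v x y = crossings (replicate k (1, True)) (H x) (H y)" for x y
      using crossings_invariant[OF vh, of x y] True inv[of x y]
      by (simp add: crossings_append string_perm_replicate flip: H_def)
    then have "crossings v x y = (if {x, y} = {a, b} then int k else 0)" for x y
      by (simp only: crossings_replicate Suc_1 pre)
    then have "crossings v x y \<noteq> 0 \<longleftrightarrow> {x, y} = {a, b}" for x y
      using k by simp
    then have "{(x, y). 1 \<le> x \<and> x < y \<and> y \<le> n \<and> crossings v x y \<noteq> 0} = {(a, b)}"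
      using ab(1-3) by (auto simp: doubleton_eq_iff)
    then show ?thesis
      using True del perm HH unfolding passes_tests_def by auto
  next
    case False
    have "string_perm v s = Transposition.transpose a b s" for s
    proof -
      \<comment> \<open>Conjugation moves the two exchanged points along \<open>H'\<close>.\<close>
      have "H' (Transposition.transpose 1 2 (H s)) = Transposition.transpose (H' 1) (H' 2) s"
        using HH by (metis (no_types, lifting) transpose_apply_first transpose_apply_second transpose_apply_other)
      also have "\<dots> = Transposition.transpose a b s"
        using ab(4) by (metis doubleton_eq_iff transpose_commute)
      finally show ?thesis using False perm by simp
    qed
    then show ?thesis
      using False del ab(1-3) unfolding passes_tests_def by auto
  qed
qed

section \<open>Correctness and error probability\<close>

lemma extracts_rightD:
  assumes "extracts_right n X" "u \<in> positive_words n" "v \<in> positive_words n" "X u v = Some u'"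
  obtains v'' where "v'' \<in> positive_words n" "u' = v'' @ v" "length u' = length u" "braid_eq n u' u"
proof -
  have "(\<exists>v''\<in>positive_words n. u' = v'' @ v) \<and> length u' = length u \<and> braid_of n u' = braid_of n u"
    using assms(1)[unfolded extracts_right_def, rule_format, OF assms(2,3)] assms(4) by simp
  moreover have "u \<in> braid_words n" using assms(2) positive_words_subset by blast
  ultimately show ?thesis
    using that by (auto simp: braid_of_eq_braid_of_iff)
qed

lemma extracts_leftD:
  assumes "extracts_left n X" "u \<in> positive_words n" "v \<in> positive_words n" "X u v = Some u'"
  obtains v'' where "v'' \<in> positive_words n" "u' = v @ v''" "length u' = length u" "braid_eq n u' u"
proof -
  have "(\<exists>v''\<in>positive_words n. u' = v @ v'') \<and> length u' = length u \<and> braid_of n u' = braid_of n u"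
    using assms(1)[unfolded extracts_left_def, rule_format, OF assms(2,3)] assms(4) by simp
  moreover have "u \<in> braid_words n" using assms(2) positive_words_subset by blast
  ultimately show ?thesis
    using that by (auto simp: braid_of_eq_braid_of_iff)
qed

text \<open>Loop invariant: the block \<open>N\<close> is never touched, and the rest stays a
  positive word of fixed length such that the whole represents the same braid. \<open>P\<close> is
  therefore arbitrary in the induction.\<close>

lemma half_twist_loop_Yes:
  assumes XL: "extracts_left n XL" and XR: "extracts_right n XR"
    and "half_twist_loop XL XR n k (Suc (length N)) l L (N @ P) = Yes q j"
    and "\<And>j t p. (j, t, p) \<in> set L \<Longrightarrow> 1 \<le> j \<and> j < n \<and> t \<le> k \<and> length N \<le> p \<and> p \<le> l"
    and "N \<in> braid_words n" "P \<in> positive_words n" "length N + length P = l"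
  shows "q \<in> braid_words n \<and> 1 \<le> j \<and> j < n \<and>
    braid_eq n (word_inv q @ (N @ P) @ q) (replicate k (j, True))"
  using assms(3-)
proof (induction L arbitrary: P)
  case Nil
  then show ?case by simp
next
  case (Cons x L)
  obtain j' t p where x: "x = (j', t, p)" by (cases x)
  have b: "1 \<le> j'" "j' < n" "t \<le> k" "length N \<le> p" "p \<le> l"
    using Cons.prems(2) by (auto simp: x)
  have L: "\<And>j t p. (j, t, p) \<in> set L \<Longrightarrow> 1 \<le> j \<and> j < n \<and> t \<le> k \<and> length N \<le> p \<and> p \<le> l"
    using Cons.prems(2) by auto
  \<comment> \<open>The smallest admissible \<open>p = length N\<close> makes \<open>P1\<close>
    empty.\<close>
  define P1 P2 where "P1 = take (p - length N) P" and "P2 = drop (p - length N) P"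
  have P: "P = P1 @ P2" by (simp add: P1_def P2_def)
  then have pos: "P1 \<in> positive_words n" "P2 \<in> positive_words n"
    using Cons.prems(4) by auto
  have len: "length P1 = p - length N" "length P2 = l - p"
    using b Cons.prems(5) by (auto simp: P1_def P2_def)
  have part1: "part (N @ P) (Suc (length N)) p = P1"
    by (simp add: part_def P1_def)
  show ?case
  proof (cases "XR P1 (replicate t (j', True))")
    case None
    then show ?thesis
      using Cons.IH[OF _ L Cons.prems(3-5)] Cons.prems(1) by (simp add: x part1)
  next
    case (Some u)
    obtain v1 where v1: "v1 \<in> positive_words n" "u = v1 @ replicate t (j', True)"
      "length u = length P1" "braid_eq n u P1"
      using extracts_rightD[OF XR pos(1) _ Some] b by auto
    have u: "u \<in> positive_words n" using v1 b by simp
    note uP = v1(4)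
    have w1: "part (N @ P) 1 (length N) @ u @ part (N @ P) (p + 1) l = N @ u @ P2"
      using b Cons.prems(5) by (simp add: part_def P2_def)
    have part2: "part (N @ u @ P2) (p + 1) l = P2"
      using v1(3) len b by (simp add: part_def)
    have eq1: "braid_eq n (N @ P) (N @ u @ P2)"
      unfolding P using uP Cons.prems(3) pos(2) positive_words_subset[of n]
      by (intro braid_eq_left braid_eq_right) (auto intro: braid_eq.sym)
    show ?thesis
    proof (cases "XL P2 (replicate (k - t) (j', True))")
      case None
      \<comment> \<open>The rewriting of \<open>P1\<close> is kept although the second extraction
        failed.\<close>
      then have "half_twist_loop XL XR n k (Suc (length N)) l L (N @ (u @ P2)) = Yes q j"
        using Cons.prems(1) Some w1 part2 by (simp add: x part1)
      then have IH: "q \<in> braid_words n \<and> 1 \<le> j \<and> j < n \<and>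
          braid_eq n (word_inv q @ (N @ u @ P2) @ q) (replicate k (j, True))"
        by (rule Cons.IH) (use L Cons.prems(3-5) u pos v1(3) len b in auto)
      then show ?thesis
        using braid_eq_context[OF eq1, of "word_inv q" q] by (auto intro: braid_eq.trans)
    next
      case (Some u')
      note XL_Some = this
      obtain v2 where v2: "v2 \<in> positive_words n" "u' = replicate (k - t) (j', True) @ v2"
        "length u' = length P2" "braid_eq n u' P2"
        using extracts_leftD[OF XL pos(2) _ Some] b by auto
      have u': "u' \<in> positive_words n" using v2 b by simp
      note uP' = v2(4)
      have w2: "part (N @ u @ P2) 1 p @ u' = N @ u @ u'"
        using v1(3) len b by (simp add: part_def)
      have eq2: "braid_eq n (N @ P) (N @ u @ u')"
      proof -
        have "braid_eq n ((N @ u) @ P2) ((N @ u) @ u')"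
          using uP' u Cons.prems(3) positive_words_subset[of n]
          by (intro braid_eq_left) (auto intro: braid_eq.sym)
        with eq1 show ?thesis by (auto intro: braid_eq.trans)
      qed
      have tp: "length v1 + t = p - length N" "length v2 + (k - t) = l - p"
        using v1 v2 len by auto
      have parts: "part (N @ u @ u') 1 (p - t) = N @ v1" "part (N @ u @ u') (p + k - t + 1) l = v2"
      proof -
        have "p - t = length (N @ v1)" using tp b by simp
        then show "part (N @ u @ u') 1 (p - t) = N @ v1"
          by (simp add: part_def v1(2))
        \<comment> \<open>The last part begins after the whole power: \<open>t\<close> of its
          letters end \<open>u\<close>, the other \<open>k - t\<close> begin \<open>u'\<close>, and
          \<open>t \<le> k\<close> makes the subtraction exact.\<close>
        have *: "p + k - t = length (N @ u @ replicate (k - t) (j', True))"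
          using v1(3) len b by simp
        have "drop (p + k - t) (N @ u @ u') = v2"
          unfolding * v2(2) by simp
        then show "part (N @ u @ u') (p + k - t + 1) l = v2"
          using tp b by (simp add: part_def)
      qed
      let ?s = "replicate k (j', True)"
      show ?thesis
      proof (cases "braid_of n ((N @ v1) @ v2) = \<one>\<^bsub>braid_group n\<^esub>")
        case True
        then have qj: "q = word_inv v2" "j = j'"
          using Cons.prems(1) \<open>XR P1 _ = Some u\<close> XL_Some w1 part2 w2 parts
          by (auto simp: x part1 Let_def)
        have words: "v1 \<in> braid_words n" "v2 \<in> braid_words n" "N \<in> braid_words n"
          using v1 v2 Cons.prems(3) positive_words_subset by auto
        have "braid_eq n ((N @ v1) @ v2) []"
          using True words by (simp add: braid_group_def braid_of_eq_iff)
        \<comment> \<open>The trivial test word is rotated cyclically to \<open>v2 @ N @ v1\<close>,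
          the prefix that arises on conjugating by \<open>word_inv v2\<close>.\<close>
        then have "braid_eq n (N @ v1) (word_inv v2)"
          using braid_eq_move_right[of n "N @ v1" v2 "[]"] by simp
        then have "braid_eq n (v2 @ N @ v1) (v2 @ word_inv v2)"
          using words(2) by (rule braid_eq_left)
        then have v: "braid_eq n (v2 @ N @ v1) []"
          using braid_eq_inv_right[OF words(2)] by (rule braid_eq.trans)
        have split: "?s = replicate t (j', True) @ replicate (k - t) (j', True)"
          using b by (simp flip: replicate_add)
        have "braid_eq n (v2 @ (N @ P) @ word_inv v2) (v2 @ (N @ u @ u') @ word_inv v2)"
          using eq2 words by (intro braid_eq_context) auto
        also have "\<dots> = (v2 @ N @ v1) @ ?s @ (v2 @ word_inv v2)"
          by (simp add: split v1(2) v2(2))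
        also have "braid_eq n \<dots> ([] @ ?s @ [])"
          using v words b braid_eq_inv_right by (intro braid_eq.append braid_eq.refl) auto
        finally show ?thesis using qj words b by simp
      next
        case False
        then have "half_twist_loop XL XR n k (Suc (length N)) l L (N @ (u @ u')) = Yes q j"
          using Cons.prems(1) \<open>XR P1 _ = Some u\<close> XL_Some w1 part2 w2 parts
          by (auto simp: x part1 Let_def)
        then have IH: "q \<in> braid_words n \<and> 1 \<le> j \<and> j < n \<and>
            braid_eq n (word_inv q @ (N @ u @ u') @ q) (replicate k (j, True))"
          by (rule Cons.IH) (use L Cons.prems(3-5) u u' v1(3) v2(3) len b in auto)
        then show ?thesis
          using braid_eq_context[OF eq2, of "word_inv q" q] by (auto intro: braid_eq.trans)
      qed
    qed
  qed
qed

text \<open>Covers empty \<open>P\<close> too: without a positive letter the default position is one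
  past the end.\<close>

lemma first_positive_append:
  assumes "\<forall>x\<in>set N. \<not> snd x" "P \<in> positive_words n"
  shows "first_positive (N @ P) = Suc (length N)"
proof -
  have "takeWhile (\<lambda>(i, e). \<not> e) P = []"
    using assms(2) by (cases P) auto
  then show ?thesis
    using assms(1) by (simp add: first_positive_def takeWhile_append2 case_prod_beta')
qed

lemma Delta_neg_power_negative: "x \<in> set (Delta_neg_power n r) \<Longrightarrow> \<not> snd x"
  by (auto simp: Delta_neg_power_def word_inv_def Delta_def split: if_splits)

text \<open>The normal form provides the split into negative letters and a positive word that the
  loop invariant needs.\<close>

lemma IsHalfTwist_Yes:
  assumes "extracts_left n XL" "extracts_right n XR" "normal_form n w"
    and "IsHalfTwist XL XR genuine n w k = Yes q j"
  shows "q \<in> braid_words n" "1 \<le> j" "j < n"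
    "braid_eq n (word_inv q @ w @ q) (replicate k (j, True))"
proof -
  obtain r P where w: "w = Delta_neg_power n r @ P" "P \<in> positive_words n"
    using assms(3) by (auto simp: normal_form_def)
  define N where "N = Delta_neg_power n r"
  have iPos: "first_positive (N @ P) = Suc (length N)"
    unfolding N_def using Delta_neg_power_negative w(2) by (intro first_positive_append) auto
  have "q \<in> braid_words n \<and> 1 \<le> j \<and> j < n \<and>
      braid_eq n (word_inv q @ (N @ P) @ q) (replicate k (j, True))"
  proof (rule half_twist_loop_Yes[OF assms(1,2)])
    show "half_twist_loop XL XR n k (Suc (length N)) (length N + length P)
      [(j, t, p). j \<leftarrow> [1..<n], t \<leftarrow> [0..<k + 1], p \<leftarrow> [length N..<length N + length P + 1]]
      (N @ P) = Yes q j"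
      using assms(4) iPos by (simp add: IsHalfTwist_def w(1) N_def Let_def split: if_splits)
  qed (use w(2) in \<open>auto simp: N_def\<close>)
  then show "q \<in> braid_words n" "1 \<le> j" "j < n"
    "braid_eq n (word_inv q @ w @ q) (replicate k (j, True))"
    by (auto simp: w(1) N_def)
qed

section \<open>The randomized procedure\<close>

lemma random_loop_Yes:
  assumes "extracts_left n XL" "extracts_right n XR" "set_pmf D \<subseteq> braid_words n" "w \<in> braid_words n"
    and "Yes q j \<in> set_pmf (random_loop XL XR genuine n D w k m r r1)"
    and "normal_form n r1" "r \<in> braid_words n" "braid_eq n r1 (word_inv r @ w @ r)"
  shows "q \<in> braid_words n \<and> 1 \<le> j \<and> j < n \<and>
    braid_eq n (word_inv q @ w @ q) (replicate k (j, True))"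
  using assms(5-)
proof (induction m arbitrary: r r1)
  case 0
  then show ?case by simp
next
  case (Suc m)
  show ?case
  proof (cases "IsHalfTwist XL XR genuine n r1 k")
    case (Yes q0 j0)
    note res = IsHalfTwist_Yes[OF assms(1,2) Suc.prems(2) Yes]
    have q: "q = r @ q0" "j = j0" using Suc.prems(1) Yes by auto
    have "braid_eq n (word_inv q0 @ (word_inv r @ w @ r) @ q0) (word_inv q0 @ r1 @ q0)"
      using res Suc.prems(4) by (intro braid_eq_context) (auto intro: braid_eq.sym)
    also have "braid_eq n \<dots> (replicate k (j, True))"
      using res q by simp
    finally show ?thesis
      using res q Suc.prems(3) by (simp add: word_inv_append)
  next
    case No
    then obtain r' where r': "r' \<in> set_pmf D"
      "Yes q j \<in> set_pmf (random_loop XL XR genuine n D w k m r' (Normalize n (word_inv r' @ w @ r')))"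
      using Suc.prems(1) by auto
    then show ?thesis
      \<comment> \<open>Every new try conjugates the original \<open>w\<close>, not
        \<open>r1\<close>, so the hypotheses hold afresh for \<open>r'\<close>.\<close>
      using assms(3,4) by (intro Suc.IH[OF r'(2)] Normalize) auto
  next
    case Genuine_No
    then show ?thesis using Suc.prems(1) by simp
  qed
qed

text \<open>The law of total probability as a real integral; it follows from the
  \<open>ennreal\<close> version since the integrand is nonnegative.\<close>

lemma measure_bind_pmf:
  "measure_pmf.prob (bind_pmf M f) A = (\<integral>x. measure_pmf.prob (f x) A \<partial>measure_pmf M)"
proof -
  have eq: "ennreal (measure_pmf.prob (bind_pmf M f) A) =
      (\<integral>\<^sup>+x. ennreal (measure_pmf.prob (f x) A) \<partial>measure_pmf M)"
    by (simp flip: measure_pmf.emeasure_eq_measure)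
  show ?thesis
    by (subst integral_eq_nn_integral) (simp_all flip: eq)
qed

text \<open>The first try is deterministic and contributes \<open>0\<close> or \<open>1\<close>; the
  \<open>m\<close> later ones use fresh draws and contribute \<open>p\<close> each. A genuine false
  would end the tries early and break the product, hence its exclusion.\<close>

lemma prob_random_loop_says_false:
  assumes "IsHalfTwist XL XR genuine n r1 k \<noteq> Genuine_No"
    and D: "\<And>r. r \<in> set_pmf D \<Longrightarrow>
      IsHalfTwist XL XR genuine n (Normalize n (word_inv r @ w @ r)) k \<noteq> Genuine_No"
    and p: "p = measure_pmf.prob D
      {r. says_false (IsHalfTwist XL XR genuine n (Normalize n (word_inv r @ w @ r)) k)}"
  shows "measure_pmf.prob (random_loop XL XR genuine n D w k (Suc m) r r1) {a. says_false a} =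
    of_bool (says_false (IsHalfTwist XL XR genuine n r1 k)) * p ^ m"
  using assms(1)
proof (induction m arbitrary: r r1)
  case 0
  \<comment> \<open>After a single failed try the loop answers false with certainty, which matches
    \<open>p ^ 0\<close>.\<close>
  then show ?case
    by (cases "IsHalfTwist XL XR genuine n r1 k") (auto simp: says_false_def)
next
  case (Suc m)
  let ?B = "{r. says_false (IsHalfTwist XL XR genuine n (Normalize n (word_inv r @ w @ r)) k)}"
  show ?case
  proof (cases "IsHalfTwist XL XR genuine n r1 k")
    case (Yes q j)
    then show ?thesis by (simp add: says_false_def)
  next
    case No
    have "measure_pmf.prob (random_loop XL XR genuine n D w k (Suc (Suc m)) r r1) {a. says_false a} =
        (\<integral>r'. measure_pmf.prob (random_loop XL XR genuine n D w k (Suc m) r'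
          (Normalize n (word_inv r' @ w @ r'))) {a. says_false a} \<partial>measure_pmf D)"
      using No by (subst random_loop.simps) (simp add: measure_bind_pmf del: random_loop.simps)
    \<comment> \<open>A genuine false is excluded only on the support of \<open>D\<close>, so the
      induction hypothesis gives equality of the integrands almost everywhere.\<close>
    also have "\<dots> = (\<integral>r'. indicator ?B r' * p ^ m \<partial>measure_pmf D)"
      by (intro integral_cong_AE AE_pmfI) (auto simp: Suc.IH D indicator_def simp del: random_loop.simps)
    also have "\<dots> = p * p ^ m"
      by (simp add: p)
    finally show ?thesis using No by (simp add: says_false_def)
  next
    case Genuine_No
    with Suc.prems show ?thesis by simp
  qed
qed

theorem proposition3p14:
  fixes n k i :: nat
    and w :: braid_word
    and XL XR :: "braid_word \<Rightarrow> braid_word \<Rightarrow> braid_word option"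
    and genuine :: "nat \<Rightarrow> braid_word \<Rightarrow> bool"
    and D :: "braid_word pmf"
    and p p' :: real
  assumes "n \<ge> 2"
    and "w \<in> braid_words n" and "w \<noteq> []" and "normal_form n w"
    and "degree w = int k" and "k \<ge> 1"
    and "i \<ge> 1"
    and "extracts_left n XL" and "extracts_right n XR"
    and "\<And>m v. v \<in> braid_words n \<Longrightarrow> genuine m v \<Longrightarrow> \<not> passes_tests n m v"
    and "set_pmf D \<subseteq> {r \<in> braid_words n. length r = length w}"
    and "p' = (if says_false (IsHalfTwist XL XR genuine n w k) then 1 else 0)"
    and "p = measure_pmf.prob D
      {r. says_false (IsHalfTwist XL XR genuine n (Normalize n (word_inv r @ w @ r)) k)}"
  shows "(\<forall>q j. Yes q j \<in> set_pmf (TestRandomHalfTwist XL XR genuine n D i w) \<longrightarrow>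
            q \<in> braid_words n \<and> j \<in> {1..n - 1} \<and>
            inv\<^bsub>braid_group n\<^esub> (braid_of n q) \<otimes>\<^bsub>braid_group n\<^esub> braid_of n w \<otimes>\<^bsub>braid_group n\<^esub> braid_of n q
              = braid_of n [(j, True)] [^]\<^bsub>braid_group n\<^esub> k) \<and>
         (half_twist_power n k (braid_of n w) \<longrightarrow>
            measure_pmf.prob (TestRandomHalfTwist XL XR genuine n D i w) {a. says_false a}
              = p' * p ^ (i - 1))"
proof (intro conjI allI impI)
  have D: "set_pmf D \<subseteq> braid_words n" using assms(11) by auto
  fix q j
  assume "Yes q j \<in> set_pmf (TestRandomHalfTwist XL XR genuine n D i w)"
  then have Yes: "Yes q j \<in> set_pmf (random_loop XL XR genuine n D w k i [] w)"
    by (simp add: TestRandomHalfTwist_def assms(5))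
  \<comment> \<open>The first try works on \<open>w\<close> itself, with
    \<open>r = []\<close>.\<close>
  have q: "q \<in> braid_words n" "1 \<le> j" "j < n"
    "braid_eq n (word_inv q @ w @ q) (replicate k (j, True))"
    using random_loop_Yes[OF assms(8,9) D assms(2) Yes assms(4)] assms(2)
    by (auto simp: word_inv_def braid_eq.refl)
  show "q \<in> braid_words n" "j \<in> {1..n - 1}" using q by auto
  have "inv\<^bsub>braid_group n\<^esub> (braid_of n q) \<otimes>\<^bsub>braid_group n\<^esub> braid_of n w \<otimes>\<^bsub>braid_group n\<^esub> braid_of n q
      = braid_of n (word_inv q @ w @ q)"
    using q assms(2) by (simp add: inv_braid_of braid_group_mult)
  also have "\<dots> = braid_of n (replicate k (j, True))"
    using q braid_eq_in_braid_words braid_of_eq_iff by blast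
  also have "\<dots> = braid_of n [(j, True)] [^]\<^bsub>braid_group n\<^esub> k"
    using braid_of_conjugate_pow[of "[]" n j k] q by (simp add: word_inv_def)
  finally show "inv\<^bsub>braid_group n\<^esub> (braid_of n q) \<otimes>\<^bsub>braid_group n\<^esub> braid_of n w \<otimes>\<^bsub>braid_group n\<^esub> braid_of n q
      = braid_of n [(j, True)] [^]\<^bsub>braid_group n\<^esub> k" .
next
  assume ht: "half_twist_power n k (braid_of n w)"
  have not_genuine: "IsHalfTwist XL XR genuine n v k \<noteq> Genuine_No"
    if "half_twist_power n k (braid_of n v)" "v \<in> braid_words n" for v
  proof -
    \<comment> \<open>Only the preliminary check can answer with a genuine false, and by hypothesis
      it does so only for words that fail the tests.\<close>
    have "half_twist_loop XL XR n k iPos l L v \<noteq> Genuine_No" for iPos l L v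
      by (induction k iPos l L v rule: half_twist_loop.induct[of _ XR XL n])
        (auto simp: Let_def split: option.split)
    moreover have "\<not> genuine k v"
      using assms(1,6,10) that half_twist_power_passes_tests by blast
    ultimately show ?thesis by (simp add: IsHalfTwist_def Let_def)
  qed
  obtain m where m: "i = Suc m" using assms(7) by (cases i) auto
  have "measure_pmf.prob (random_loop XL XR genuine n D w k (Suc m) [] w) {a. says_false a} =
      of_bool (says_false (IsHalfTwist XL XR genuine n w k)) * p ^ m"
  proof (rule prob_random_loop_says_false[OF _ _ assms(13)])
    show "IsHalfTwist XL XR genuine n w k \<noteq> Genuine_No"
      using not_genuine ht assms(2) by blast
  next
    fix r assume "r \<in> set_pmf D"
    then have r: "r \<in> braid_words n" using assms(11) by auto
    have v: "word_inv r @ w @ r \<in> braid_words n" using r assms(2) by simp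
    \<comment> \<open>Conjugation and normalization preserve half-twist powers, so the same argument
      covers all later tries.\<close>
    show "IsHalfTwist XL XR genuine n (Normalize n (word_inv r @ w @ r)) k \<noteq> Genuine_No"
      using half_twist_power_conjugate[OF ht assms(2) r assms(1) Normalize(2)[OF v]]
        normal_form_in_braid_words[OF Normalize(1)[OF v]] by (rule not_genuine)
  qed
  then show "measure_pmf.prob (TestRandomHalfTwist XL XR genuine n D i w) {a. says_false a}
      = p' * p ^ (i - 1)"
    by (simp add: TestRandomHalfTwist_def assms(5,12) m)
qed

end
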